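(* Let $(\mathcal G,\Delta,\{V^i,U^i\}_{i=1}^n)$ be a partition exchange economy whose directed compatibility graph $\mathcal G$ can be represented by a set of $t$ types, with cycle bound $\Delta$. Then the $(\Delta-1)n(t+1)$-supplemented core is nonempty; moreover, it contains an exchange that is Pareto optimal in the corresponding extended graph $\mathcal G^{+V^0}$.
   Context: A partition exchange economy consists of organizations $N=\{1,\dots,n\}$; pairwise disjoint finite sets $V^1,\dots,V^n$, $V=\bigcup_iV^i$; patient sets $U^i\subseteq V^i$; a directed compatibility graph $\mathcal G=(V,E)$; and a cycle bound $\Delta\ge2$. An exchange among $W\subseteq V$ is a set of vertex-disjoint directed cycles of length at most $\Delta$ in $\mathcal G[W]$; $u_i(\mathcal E)$ is the number of vertices of $U^i$ lying on cycles of $\mathcal E$. A directed graph $\mathcal G$ can be represented by a set of types $T$ if there is $f:V\to T$ such that for all $t_1,t_2\in T$, either all pairs $(u,v)$, $u\ne v$, with $f(u)=t_1,f(v)=t_2$ are arcs or none are; by convention no arc joins two vertices of the same type. Given a finite set $V^0$ of new vertices (additional altruistic donors, in no organization), $\mathcal G^{+V^0}$ adds these vertices, an arc from every other vertex into each $a\in V^0$, and for each $a\in V^0$ arcs from $a$ to an arbitrarily chosen set of vertices; exchanges in $\mathcal G^{+V^0}$ are sets of vertex-disjoint cycles of length $\le\Delta$ in it. A nonempty coalition $P\subseteq N$ blocks an exchange $\mathcal E$ if some exchange $\mathcal E'$ among $\bigcup_{i\in P}V^i$ (in $\mathcal G$) has $u_i(\mathcal E')>u_i(\mathcal E)$ for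 all $i\in P$. An exchange of $\mathcal G^{+V^0}$ blocked by no coalition is in the $V^0$-supplemented core; the $d$-supplemented core is nonempty if for some $V^0$ with $|V^0|\le d$ and some choice of its out-arcs the $V^0$-supplemented core is nonempty. An exchange $\mathcal E^*$ of $\mathcal G^{+V^0}$ is Pareto optimal if no exchange $\mathcal E'$ of $\mathcal G^{+V^0}$ has $u_i(\mathcal E')\ge u_i(\mathcal E^* )$ for all $i$ with strict inequality for some $i$. *)

theory Defs
  imports Main
begin

definition dcycle :: "('a \<times> 'a) set \<Rightarrow> 'a set \<Rightarrow> 'a list \<Rightarrow> bool" where
  "dcycle E W c \<longleftrightarrow> c \<noteq> [] \<and> distinct c \<and> set c \<subseteq> W \<and>
     (\<forall>j < length c. (c ! j, c ! ((j + 1) mod length c)) \<in> E)"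

definition is_exchange :: "('a \<times> 'a) set \<Rightarrow> nat \<Rightarrow> 'a set \<Rightarrow> 'a list set \<Rightarrow> bool" where
  "is_exchange E \<Delta> W X \<longleftrightarrow>
     (\<forall>c\<in>X. dcycle E W c \<and> length c \<le> \<Delta>) \<and>
     (\<forall>c\<in>X. \<forall>c'\<in>X. c \<noteq> c' \<longrightarrow> set c \<inter> set c' = {})"

definition covered :: "'a list set \<Rightarrow> 'a set" where
  "covered X = (\<Union>c\<in>X. set c)"

definition util :: "'a set \<Rightarrow> 'a list set \<Rightarrow> nat" where
  "util Ui X = card (Ui \<inter> covered X)"

definition represented_by :: "('v \<times> 'v) set \<Rightarrow> 'v set \<Rightarrow> 't set \<Rightarrow> ('v \<Rightarrow> 't) \<Rightarrow> bool" where
  "represented_by E V T f \<longleftrightarrow> f ` V \<subseteq> T \<and>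
     (\<forall>u\<in>V. \<forall>v\<in>V. \<forall>u'\<in>V. \<forall>v'\<in>V. u \<noteq> v \<longrightarrow> u' \<noteq> v' \<longrightarrow> f u = f u' \<longrightarrow> f v = f v'
         \<longrightarrow> ((u, v) \<in> E \<longleftrightarrow> (u', v') \<in> E)) \<and>
     (\<forall>u\<in>V. \<forall>v\<in>V. f u = f v \<longrightarrow> (u, v) \<notin> E)"

text \<open>Extended graph G^{+V^0}: original vertices Inl v (v in V), new altruistic
  donors Inr a (a in A); arcs of G, an arc from every other vertex into each
  new donor, and arcs from each new donor a to the chosen set out a of
  original vertices.\<close>
definition ext_vertices :: "'v set \<Rightarrow> nat set \<Rightarrow> ('v + nat) set" where
  "ext_vertices V A = Inl ` V \<union> Inr ` A"

definition ext_arcs :: "('v \<times> 'v) set \<Rightarrow> 'v set \<Rightarrow> nat set \<Rightarrow> (nat \<Rightarrow> 'v set)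
    \<Rightarrow> (('v + nat) \<times> ('v + nat)) set" where
  "ext_arcs E V A out =
     {(Inl u, Inl v) | u v. (u, v) \<in> E} \<union>
     {(x, Inr a) | x a. a \<in> A \<and> x \<in> ext_vertices V A \<and> x \<noteq> Inr a} \<union>
     {(Inr a, Inl v) | a v. a \<in> A \<and> v \<in> out a}"

definition blocks :: "('v \<times> 'v) set \<Rightarrow> nat \<Rightarrow> (nat \<Rightarrow> 'v set) \<Rightarrow> (nat \<Rightarrow> 'v set)
    \<Rightarrow> nat \<Rightarrow> nat set \<Rightarrow> ('v + nat) list set \<Rightarrow> bool" where
  "blocks E \<Delta> Vs Us n P X \<longleftrightarrow> P \<noteq> {} \<and> P \<subseteq> {1..n} \<and>
     (\<exists>X'. is_exchange E \<Delta> (\<Union>i\<in>P. Vs i) X' \<and>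
        (\<forall>i\<in>P. util (Us i) X' > util (Inl ` Us i) X))"

definition in_supp_core :: "('v \<times> 'v) set \<Rightarrow> nat \<Rightarrow> (nat \<Rightarrow> 'v set) \<Rightarrow> (nat \<Rightarrow> 'v set)
    \<Rightarrow> nat \<Rightarrow> nat set \<Rightarrow> (nat \<Rightarrow> 'v set) \<Rightarrow> ('v + nat) list set \<Rightarrow> bool" where
  "in_supp_core E \<Delta> Vs Us n A out X \<longleftrightarrow>
     is_exchange (ext_arcs E (\<Union>i\<in>{1..n}. Vs i) A out) \<Delta>
        (ext_vertices (\<Union>i\<in>{1..n}. Vs i) A) X \<and>
     (\<forall>P. \<not> blocks E \<Delta> Vs Us n P X)"

definition ext_pareto_optimal :: "('v \<times> 'v) set \<Rightarrow> nat \<Rightarrow> (nat \<Rightarrow> 'v set) \<Rightarrow> (nat \<Rightarrow> 'v set)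
    \<Rightarrow> nat \<Rightarrow> nat set \<Rightarrow> (nat \<Rightarrow> 'v set) \<Rightarrow> ('v + nat) list set \<Rightarrow> bool" where
  "ext_pareto_optimal E \<Delta> Vs Us n A out X \<longleftrightarrow>
     is_exchange (ext_arcs E (\<Union>i\<in>{1..n}. Vs i) A out) \<Delta>
        (ext_vertices (\<Union>i\<in>{1..n}. Vs i) A) X \<and>
     \<not> (\<exists>X'. is_exchange (ext_arcs E (\<Union>i\<in>{1..n}. Vs i) A out) \<Delta>
              (ext_vertices (\<Union>i\<in>{1..n}. Vs i) A) X' \<and>
            (\<forall>i\<in>{1..n}. util (Inl ` Us i) X' \<ge> util (Inl ` Us i) X) \<and>
            (\<exists>i\<in>{1..n}. util (Inl ` Us i) X' > util (Inl ` Us i) X))"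

end

theory Submission
  imports Defs "HOL-Analysis.Brouwer_Fixpoint"
begin

text \<open>
  A payoff vector \<open>W\<close> is found that no coalition can strictly improve on, together with a
  fractional exchange giving every organization \<open>i\<close> more than \<open>W i - 1\<close> matched patients.  The
  usage of each pair (organization, type) by this exchange is a conic combination of
  vectors indexed by the \<open>n * t\<close> pairs, so by Caratheodory it is attained with at most \<open>n * t\<close>
  cycles.  Round all multiplicities up, serve patients before other vertices of the same
  pair, and let altruists replace the vertices that are missing.  Only the one additional copy of
  a fractional cycle can miss vertices, and it is dropped unless it keeps an actual vertex, so
  it needs at most \<open>\<Delta> - 1\<close> altruists.  Integrality lifts the utility of \<open>i\<close> to at
  least \<open>W i\<close>, and maximizing total utility under these lower bounds gives Pareto optimality.
\<close>

lemma Min_image_attained: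
  assumes "finite P" "P \<noteq> {}"
  shows "\<exists>i\<in>P. (MIN i\<in>P. h i) = h i"
proof -
  have "Min (h ` P) \<in> h ` P" using assms by (intro Min_in) auto
  then show ?thesis by blast
qed

lemma Min_diff_le_shift:
  fixes w w' :: "'i \<Rightarrow> real"
  assumes "finite P" "P \<noteq> {}" and "\<And>i. i \<in> P \<Longrightarrow> w' i \<le> w i + d"
  shows "(MIN i\<in>P. a i - w i) \<le> (MIN i\<in>P. a i - w' i) + d"
proof -
  obtain j where j: "j \<in> P" "(MIN i\<in>P. a i - w' i) = a j - w' j"
    using Min_image_attained[OF assms(1,2)] by blast
  have "(MIN i\<in>P. a i - w i) \<le> a j - w j"
    using assms j by (intro Min_le) auto
  then show ?thesis using j assms(3)[of j] by linarith
qed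

text \<open>
  Think of \<open>P k\<close> as a coalition that can secure \<open>a k i\<close> for its members \<open>i\<close>.  For a payoff
  vector \<open>w\<close>, let \<open>\<psi> k w = max 0 (1 + (MIN i\<in>P k. a k i - w i))\<close>.  At a \<open>w\<close> where
  \<open>G w i = (\<Sum>k | i \<in> P k. \<psi> k w)\<close> equals 1 for all \<open>i\<close>, the \<open>\<psi> k w\<close> are balancing weights;
  \<open>\<psi> k w \<le> 1\<close> says that \<open>k\<close> does not improve on \<open>w\<close>, and \<open>\<psi> k w > 0\<close> says that \<open>k\<close> gives
  its members more than \<open>w i - 1\<close>.  Kuhn's lemma on a fine grid yields an approximate such \<open>w\<close>,
  the singleton coalitions providing the boundary condition at \<open>w i = 0\<close>.
\<close>

lemma approximate_balanced_core:
  fixes a :: "'k \<Rightarrow> nat \<Rightarrow> nat" and P :: "'k \<Rightarrow> nat set" and \<eta> :: real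
  assumes finK: "finite K"
    and P: "\<And>k. k \<in> K \<Longrightarrow> P k \<noteq> {}" "\<And>k. k \<in> K \<Longrightarrow> P k \<subseteq> {1..n}"
    and single: "\<And>i. i \<in> {1..n} \<Longrightarrow> \<exists>k\<in>K. P k = {i}"
    and \<eta>: "0 < \<eta>" "\<eta> \<le> 1"
  obtains x :: "'k \<Rightarrow> real" and W :: "nat \<Rightarrow> nat"
  where "\<And>k. k \<in> K \<Longrightarrow> 0 \<le> x k"
    and "\<And>i. i \<in> {1..n} \<Longrightarrow> 1 - \<eta> \<le> (\<Sum>k | k \<in> K \<and> i \<in> P k. x k)"
    and "\<And>i. i \<in> {1..n} \<Longrightarrow> (\<Sum>k | k \<in> K \<and> i \<in> P k. x k) \<le> 1"
    and "\<And>k i. k \<in> K \<Longrightarrow> 0 < x k \<Longrightarrow> i \<in> P k \<Longrightarrow> W i \<le> a k i"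
    and "\<And>k. k \<in> K \<Longrightarrow> \<exists>i\<in>P k. a k i \<le> W i"
proof -
  have finP: "finite (P k)" if "k \<in> K" for k
    using P(2)[OF that] finite_subset by blast
  define M where "M = Max (insert 0 ((\<lambda>(k, i). a k i) ` (K \<times> {1..n})))"
  have M: "a k i \<le> M" if "k \<in> K" "i \<in> {1..n}" for k i
    unfolding M_def using finK that by (intro Max_ge) auto
  define L where "L = real M + 1"
  have L: "0 < L" by (simp add: L_def)
  define m where "m = (\<lambda>k (w :: nat \<Rightarrow> real). MIN i\<in>P k. real (a k i) - w i)"
  define \<psi> where "\<psi> = (\<lambda>k w. max 0 (1 + m k w))"
  define G where "G = (\<lambda>w i. \<Sum>k | k \<in> K \<and> i \<in> P k. \<psi> k w)"
  have m_le: "m k w \<le> real (a k i) - w i" if "k \<in> K" "i \<in> P k" for k w i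
    unfolding m_def using that finP by (intro Min_le) auto
  have m_in: "\<exists>i\<in>P k. m k w = real (a k i) - w i" if "k \<in> K" for k w
    unfolding m_def using that finP P(1) by (intro Min_image_attained)
  have \<psi>_nonneg: "0 \<le> \<psi> k w" for k w by (simp add: \<psi>_def)
  have \<psi>_le_G: "\<psi> k w \<le> G w i" if "k \<in> K" "i \<in> P k" for k w i
    unfolding G_def using that finK \<psi>_nonneg by (intro member_le_sum) auto
  have G_shift: "G w i \<le> G w' i + real (card K) * d"
    if d: "0 \<le> d" "\<And>j. j \<in> {1..n} \<Longrightarrow> w' j \<le> w j + d" for w w' i d
  proof -
    have "\<psi> k w \<le> \<psi> k w' + d" if k: "k \<in> K" for k
    proof -
      have "m k w \<le> m k w' + d"
        unfolding m_def by (rule Min_diff_le_shift) (use k P finP d(2) in blast)+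
      then show ?thesis using d(1) by (auto simp: \<psi>_def)
    qed
    then have "G w i \<le> (\<Sum>k | k \<in> K \<and> i \<in> P k. \<psi> k w' + d)"
      unfolding G_def by (intro sum_mono) auto
    also have "\<dots> = G w' i + real (card {k \<in> K. i \<in> P k}) * d"
      by (simp add: G_def sum.distrib)
    also have "\<dots> \<le> G w' i + real (card K) * d"
      using d(1) finK by (intro add_left_mono mult_right_mono) (auto intro: card_mono)
    finally show ?thesis .
  qed
  obtain p :: nat where p: "real (card K) * L / (\<eta> / 2) < real p"
    using reals_Archimedean2 by blast
  have p0: "0 < p"
  proof -
    have "0 \<le> real (card K) * L / (\<eta> / 2)" using L \<eta> by simp
    with p show ?thesis by linarith
  qed
  define d where "d = L / real p"
  have d0: "0 \<le> d" using L by (simp add: d_def)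
  have d: "real (card K) * d \<le> \<eta> / 2"
    using p p0 \<eta> by (simp add: d_def field_simps)
  define w where "w = (\<lambda>(y :: nat \<Rightarrow> nat) i. d * real (y (i - 1)))"
  define label where "label = (\<lambda>y i. if 1 - \<eta> / 2 \<le> G (w y) (Suc i) then 0 else 1 :: nat)"
  have low: "1 \<le> G (w y) (Suc i)" if i: "i < n" "y i = 0" for y i
  proof -
    obtain k where k: "k \<in> K" "P k = {Suc i}" using single[of "Suc i"] i by auto
    have "m k (w y) = a k (Suc i)" using k i by (simp add: m_def w_def)
    then have "1 \<le> \<psi> k (w y)" by (simp add: \<psi>_def)
    also have "\<dots> \<le> G (w y) (Suc i)" using k by (intro \<psi>_le_G) auto
    finally show ?thesis .
  qed
  have high: "G (w y) (Suc i) = 0" if i: "i < n" "y i = p" for y i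
  proof -
    have "\<psi> k (w y) = 0" if k: "k \<in> K" "Suc i \<in> P k" for k
    proof -
      have "w y (Suc i) = L" using i p0 by (simp add: w_def d_def)
      moreover have "a k (Suc i) \<le> M" using k i by (intro M) auto
      ultimately show ?thesis
        using m_le[OF k, of "w y"] by (simp add: \<psi>_def L_def)
    qed
    then show ?thesis by (simp add: G_def)
  qed
  have label_low: "label y i = 0" if "i < n" "y i = 0" for y i
    using low[of i y, OF that] \<eta> by (simp add: label_def)
  have label_high: "label y i = 1" if "i < n" "y i = p" for y i
    using high[of i y, OF that] \<eta> by (simp add: label_def)
  obtain q where q: "\<forall>i<n. \<exists>r s. (\<forall>j<n. q j \<le> r j \<and> r j \<le> q j + 1) \<and> (\<forall>j<n. q j \<le> s j \<and> s j \<le> q j + 1) \<and> label r i \<noteq> label s i"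
  proof (rule kuhn_lemma[of p n label])
    show "\<forall>y. (\<forall>i<n. y i \<le> p) \<longrightarrow> (\<forall>i<n. y i = 0 \<longrightarrow> label y i = 0)"
      using label_low by blast
    show "\<forall>y. (\<forall>i<n. y i \<le> p) \<longrightarrow> (\<forall>i<n. y i = p \<longrightarrow> label y i = 1)"
      using label_high by blast
  qed (use p0 in \<open>auto simp: label_def\<close>)
  have close: "w y j \<le> w y' j + d"
    if "j \<in> {1..n}" "\<forall>j<n. q j \<le> y j \<and> y j \<le> q j + 1"
      "\<forall>j<n. q j \<le> y' j \<and> y' j \<le> q j + 1" for y y' j
  proof -
    have "j - 1 < n" using that by auto
    then have "y (j - 1) \<le> y' (j - 1) + 1" using that(2,3) by fastforce
    then have "real (y (j - 1)) \<le> real (y' (j - 1)) + 1" by linarith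
    then have "d * real (y (j - 1)) \<le> d * (real (y' (j - 1)) + 1)"
      using d0 by (intro mult_left_mono)
    then show ?thesis by (simp add: w_def algebra_simps)
  qed
  have G: "1 - \<eta> \<le> G (w q) i \<and> G (w q) i \<le> 1" if i: "i \<in> {1..n}" for i
  proof -
    have "i - 1 < n" "Suc (i - 1) = i" using i by auto
    then obtain r s where rs: "\<forall>j<n. q j \<le> r j \<and> r j \<le> q j + 1"
      "\<forall>j<n. q j \<le> s j \<and> s j \<le> q j + 1" "label r (i - 1) \<noteq> label s (i - 1)"
      using q by blast
    have near: "G (w q) i \<le> G (w y) i + \<eta> / 2 \<and> G (w y) i \<le> G (w q) i + \<eta> / 2"
      if y: "\<forall>j<n. q j \<le> y j \<and> y j \<le> q j + 1" for y
      using G_shift[OF d0, of "w y" "w q" i] G_shift[OF d0, of "w q" "w y" i]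
        close[of _ y q] close[of _ q y] y d by fastforce
    show ?thesis
      using rs(3) near[OF rs(1)] near[OF rs(2)] \<open>Suc (i - 1) = i\<close>
      by (auto simp: label_def split: if_splits)
  qed
  have w_nonneg: "0 \<le> w q i" for i using d0 by (simp add: w_def)
  show thesis
  proof (rule that[of "\<lambda>k. \<psi> k (w q)" "\<lambda>i. nat \<lfloor>w q i\<rfloor>"])
    fix k i assume k: "k \<in> K" "0 < \<psi> k (w q)" "i \<in> P k"
    then have "w q i < real (a k i) + 1"
      using m_le[of k i "w q"] by (simp add: \<psi>_def)
    then show "nat \<lfloor>w q i\<rfloor> \<le> a k i" by linarith
  next
    fix k assume k: "k \<in> K"
    obtain i where i: "i \<in> P k" "m k (w q) = real (a k i) - w q i" using m_in[OF k] by blast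
    have "\<psi> k (w q) \<le> 1" using \<psi>_le_G[OF k i(1), of "w q"] G[of i] i P(2)[OF k] by fastforce
    then have "real (a k i) \<le> w q i" using i by (simp add: \<psi>_def)
    then show "\<exists>i\<in>P k. a k i \<le> nat \<lfloor>w q i\<rfloor>" using i by (intro bexI[of _ i]) linarith+
  qed (use \<psi>_nonneg G in \<open>auto simp: G_def\<close>)
qed

lemma homogeneous_system_nontrivial_solution:
  fixes M :: "'c \<Rightarrow> 'r \<Rightarrow> 'f::field"
  assumes "finite R" "finite C" "card R < card C"
  shows "\<exists>l. (\<exists>c\<in>C. l c \<noteq> 0) \<and> (\<forall>r\<in>R. (\<Sum>c\<in>C. l c * M c r) = 0)"
  using assms
proof (induction R arbitrary: C M rule: finite_induct)
  case empty
  then obtain c where "c \<in> C" by fastforce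
  then show ?case by (intro exI[of _ "\<lambda>_. 1"]) auto
next
  case (insert r0 R)
  show ?case
  proof (cases "\<forall>c\<in>C. M c r0 = 0")
    case True
    obtain l where l: "\<exists>c\<in>C. l c \<noteq> 0" "\<forall>r\<in>R. (\<Sum>c\<in>C. l c * M c r) = 0"
      using insert.IH[of C M] insert.prems insert.hyps by auto
    then show ?thesis using True by (intro exI[of _ l]) auto
  next
    case False
    then obtain c0 where c0: "c0 \<in> C" "M c0 r0 \<noteq> 0" by blast
    define C' where "C' = C - {c0}"
    have C': "finite C'" "c0 \<notin> C'" "C = insert c0 C'" using c0 insert.prems by (auto simp: C'_def)
    define M' where "M' = (\<lambda>c r. M c r - M c r0 / M c0 r0 * M c0 r)"
    obtain l where l: "\<exists>c\<in>C'. l c \<noteq> 0" "\<forall>r\<in>R. (\<Sum>c\<in>C'. l c * M' c r) = 0"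
      using insert.IH[of C' M'] insert.prems insert.hyps C' by auto
    define s where "s = (\<Sum>c\<in>C'. l c * M c r0)"
    define l' where "l' = l(c0 := - s / M c0 r0)"
    have sum_l': "(\<Sum>c\<in>C. l' c * M c r) = - s / M c0 r0 * M c0 r + (\<Sum>c\<in>C'. l c * M c r)" for r
    proof -
      have "(\<Sum>c\<in>C'. l' c * M c r) = (\<Sum>c\<in>C'. l c * M c r)"
        using C' by (intro sum.cong) (auto simp: l'_def)
      then show ?thesis using C' by (simp add: l'_def)
    qed
    have "(\<Sum>c\<in>C. l' c * M c r) = 0" if r: "r \<in> insert r0 R" for r
    proof (cases "r = r0")
      case True
      then show ?thesis using c0 by (simp add: sum_l' s_def)
    next
      case False
      then have "0 = (\<Sum>c\<in>C'. l c * M' c r)" using l r by auto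
      also have "\<dots> = (\<Sum>c\<in>C'. l c * M c r - l c * M c r0 * (M c0 r / M c0 r0))"
        by (intro sum.cong) (auto simp: M'_def algebra_simps)
      also have "\<dots> = (\<Sum>c\<in>C'. l c * M c r) - s * (M c0 r / M c0 r0)"
        by (simp only: sum_subtractf s_def sum_distrib_right)
      finally show ?thesis by (simp add: sum_l')
    qed
    moreover have "\<exists>c\<in>C. l' c \<noteq> 0" using l(1) C' by (auto simp: l'_def)
    ultimately show ?thesis by blast
  qed
qed

lemma conic_caratheodory:
  fixes M :: "'c \<Rightarrow> 'r \<Rightarrow> real" and z :: "'c \<Rightarrow> real"
  assumes "finite R" "finite C" "\<And>c. c \<in> C \<Longrightarrow> 0 \<le> z c"
  obtains z' where "\<And>c. c \<in> C \<Longrightarrow> 0 \<le> z' c"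
    and "\<And>r. r \<in> R \<Longrightarrow> (\<Sum>c\<in>C. z' c * M c r) = (\<Sum>c\<in>C. z c * M c r)"
    and "card {c \<in> C. 0 < z' c} \<le> card R"
proof -
  define good where "good = (\<lambda>z'. (\<forall>c\<in>C. 0 \<le> z' c) \<and>
    (\<forall>r\<in>R. (\<Sum>c\<in>C. z' c * M c r) = (\<Sum>c\<in>C. z c * M c r)))"
  have "good z" using assms by (auto simp: good_def)
  then obtain z' where z': "good z'"
    and min: "\<And>y. good y \<Longrightarrow> card {c \<in> C. 0 < z' c} \<le> card {c \<in> C. 0 < y c}"
    using ex_has_least_nat[of good z "\<lambda>y. card {c \<in> C. 0 < y c}"] by blast
  define S where "S = {c \<in> C. 0 < z' c}"
  have S: "finite S" "S \<subseteq> C" using assms by (auto simp: S_def)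
  have "card S \<le> card R"
  proof (rule ccontr)
    assume "\<not> card S \<le> card R"
    then obtain l0 where l0: "\<exists>c\<in>S. l0 c \<noteq> 0" "\<forall>r\<in>R. (\<Sum>c\<in>S. l0 c * M c r) = 0"
      using homogeneous_system_nontrivial_solution[of R S M] assms S by auto
    obtain l where l: "\<exists>c\<in>S. 0 < l c" "\<forall>r\<in>R. (\<Sum>c\<in>S. l c * M c r) = 0"
    proof (cases "\<exists>c\<in>S. 0 < l0 c")
      case False
      then have "\<exists>c\<in>S. 0 < - l0 c" using l0 by force
      then show thesis using l0 by (intro that[of "\<lambda>c. - l0 c"]) (auto simp: sum_negf)
    qed (use l0 that in blast)
    define S' where "S' = {c \<in> S. 0 < l c}"
    have S': "finite S'" "S' \<noteq> {}" using l S by (auto simp: S'_def)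
    define e where "e = (MIN c\<in>S'. z' c / l c)"
    obtain c0 where c0: "c0 \<in> S'" "e = z' c0 / l c0"
      unfolding e_def using Min_image_attained[OF S'] by blast
    have e_le: "e \<le> z' c / l c" if "c \<in> S'" for c
      unfolding e_def using that S' by (intro Min_le) auto
    have e0: "0 < e" using c0 by (auto simp: S'_def S_def)
    define y where "y = (\<lambda>c. if c \<in> S then z' c - e * l c else 0)"
    have y0: "0 \<le> y c" if "c \<in> C" for c
    proof (cases "c \<in> S \<and> 0 < l c")
      case True
      then show ?thesis using e_le[of c] by (auto simp: y_def S'_def field_simps)
    next
      case False
      then have "c \<in> S \<Longrightarrow> e * l c \<le> 0" using e0 by (auto simp: mult_nonneg_nonpos)
      then show ?thesis by (auto simp: y_def S_def)
    qed
    have "(\<Sum>c\<in>C. y c * M c r) = (\<Sum>c\<in>C. z c * M c r)" if "r \<in> R" for r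
    proof -
      have "(\<Sum>c\<in>C. y c * M c r) = (\<Sum>c\<in>S. y c * M c r)"
        using S assms by (intro sum.mono_neutral_right) (auto simp: y_def)
      also have "\<dots> = (\<Sum>c\<in>S. z' c * M c r - e * (l c * M c r))"
        by (intro sum.cong) (auto simp: y_def algebra_simps)
      also have "\<dots> = (\<Sum>c\<in>S. z' c * M c r) - e * (\<Sum>c\<in>S. l c * M c r)"
        by (simp only: sum_subtractf sum_distrib_left)
      also have "\<dots> = (\<Sum>c\<in>S. z' c * M c r)" using l that by simp
      also have "\<dots> = (\<Sum>c\<in>C. z' c * M c r)"
        using S assms z' by (intro sum.mono_neutral_left) (force simp: S_def good_def)+
      finally show ?thesis using z' that by (auto simp: good_def)
    qed
    with y0 have "card S \<le> card {c \<in> C. 0 < y c}" unfolding S_def by (intro min) (auto simp: good_def)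
    also have "\<dots> \<le> card (S - {c0})"
      using c0 S by (intro card_mono) (auto simp: y_def S'_def split: if_splits)
    also have "\<dots> < card S" using c0 S by (intro psubset_card_mono) (auto simp: S'_def)
    finally show False by simp
  qed
  with z' show thesis by (intro that[of z']) (auto simp: good_def S_def)
qed

lemma priority_assignment:
  assumes "finite V" "U \<subseteq> V" "finite S" "S0 \<subseteq> S" "card S0 \<le> card V"
  obtains R g where "S0 \<subseteq> R" "R \<subseteq> S" "inj_on g R" "g ` R \<subseteq> V"
    "min (card U) (card S) \<le> card (U \<inter> g ` R)"
proof -
  obtain R where R: "S0 \<subseteq> R" "R \<subseteq> S" "card R = min (card S) (card V)"
    using exists_subset_between[of S0 "min (card S) (card V)" S] assms card_mono[of S S0] by auto
  have finU: "finite U" "card U \<le> card V" using assms finite_subset card_mono by blast+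
  obtain V' where V': "V' \<subseteq> V" "card V' = card R" "V' \<subseteq> U \<or> U \<subseteq> V'"
  proof (cases "card R \<le> card U")
    case True
    then obtain V' where "V' \<subseteq> U" "card V' = card R" using obtain_subset_with_card_n by metis
    then show thesis using assms that by blast
  next
    case False
    then obtain V' where "U \<subseteq> V'" "V' \<subseteq> V" "card V' = card R"
      using exists_subset_between[of U "card R" V] assms R by force
    then show thesis using that by blast
  qed
  have fin: "finite V'" "finite R" using V' R assms finite_subset by blast+
  obtain g where g: "bij_betw g R V'"
    using finite_same_card_bij[OF fin(2,1)] V' by auto
  then have gR: "inj_on g R" "g ` R = V'" by (auto simp: bij_betw_def)
  have "min (card U) (card S) \<le> card (U \<inter> V')"
    using V'(3)
  proof
    assume "V' \<subseteq> U"
    then have "U \<inter> V' = V'" by blast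
    then show ?thesis using V' R finU by auto
  next
    assume "U \<subseteq> V'"
    then have "U \<inter> V' = U" by blast
    then show ?thesis by auto
  qed
  then show thesis using that[of R g] R gR V' by auto
qed

lemma finite_dcycles: "finite V \<Longrightarrow> finite {c. dcycle E V c \<and> length c \<le> \<Delta>}"
  by (rule finite_subset[OF _ finite_subset_distinct[of V]]) (auto simp: dcycle_def)

lemma card_nth_class:
  assumes "distinct c"
  shows "card {j. j < length c \<and> \<kappa> (c ! j) = k} = card {v \<in> set c. \<kappa> v = k}"
proof -
  have "bij_betw ((!) c) {j. j < length c \<and> \<kappa> (c ! j) = k} {v \<in> set c. \<kappa> v = k}"
    using assms by (auto simp: bij_betw_def inj_on_def nth_eq_iff_index_eq in_set_conv_nth)
  then show ?thesis by (rule bij_betw_same_card)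
qed

lemma round_up_fractional_exchange:
  fixes E :: "('v \<times> 'v) set" and V U :: "'v set" and \<Delta> :: nat and \<kappa> :: "'v \<Rightarrow> 'k" and z :: "'v list \<Rightarrow> real"
  defines "C \<equiv> {c. dcycle E V c \<and> length c \<le> \<Delta>}"
  defines "y \<equiv> \<lambda>k. \<Sum>c\<in>C. z c * real (card {v \<in> set c. \<kappa> v = k})"
  assumes finV: "finite V" and finK: "finite K" and UV: "U \<subseteq> V"
    and rep: "represented_by E V K \<kappa>"
    and z: "\<And>c. c \<in> C \<Longrightarrow> 0 \<le> z c"
    and cap: "\<And>k. k \<in> K \<Longrightarrow> y k \<le> real (card {v \<in> V. \<kappa> v = k})"
  obtains A :: "nat set" and X where "finite A" "card A \<le> (\<Delta> - 1) * card K"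
    "is_exchange (ext_arcs E V A (\<lambda>_. V)) \<Delta> (ext_vertices V A) X"
    "\<And>k. k \<in> K \<Longrightarrow>
       min (real (card {v \<in> U. \<kappa> v = k})) (y k) \<le> real (card (Inl ` {v \<in> U. \<kappa> v = k} \<inter> covered X))"
proof -
  have finC: "finite C" unfolding C_def by (rule finite_dcycles[OF finV])
  define cnt where "cnt = (\<lambda>c k. card {v \<in> set c. \<kappa> v = k})"
  obtain z' where z': "\<And>c. c \<in> C \<Longrightarrow> 0 \<le> z' c"
    and z'_eq: "\<And>k. k \<in> K \<Longrightarrow>
      (\<Sum>c\<in>C. z' c * real (cnt c k)) = (\<Sum>c\<in>C. z c * real (cnt c k))"
    and supp: "card {c \<in> C. 0 < z' c} \<le> card K"
    by (rule conic_caratheodory[OF finK finC, where z = z and M = "\<lambda>c k. real (cnt c k)"])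
      (use z in blast)+
  have y: "(\<Sum>c\<in>C. z' c * real (cnt c k)) = y k" if "k \<in> K" for k
    using z'_eq[OF that] by (simp add: y_def cnt_def)
  define q where "q = (\<lambda>c. nat \<lceil>z' c\<rceil>)"
  define b where "b = (\<lambda>c. nat \<lfloor>z' c\<rfloor>)"
  have b_le_q: "b c \<le> q c" for c unfolding b_def q_def by linarith
  have z'_le_q: "z' c \<le> real (q c)" for c unfolding q_def by linarith
  have b_le_z': "real (b c) \<le> z' c" if "c \<in> C" for c using z'[OF that] by (simp add: b_def)
  have q_le_b: "q c \<le> b c + 1" for c unfolding q_def b_def by linarith
  have q_pos: "0 < z' c" if "0 < q c" for c using that by (auto simp: q_def)

  define slots where "slots = (\<lambda>(r :: 'v list \<Rightarrow> nat) k.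
    SIGMA c:C. {..<r c} \<times> {j. j < length c \<and> \<kappa> (c ! j) = k})"
  have fin_slots: "finite (slots r k)" for r k
    unfolding slots_def using finC by (intro finite_SigmaI) auto
  have card_slots: "card (slots r k) = (\<Sum>c\<in>C. r c * cnt c k)" for r k
  proof -
    have "card (slots r k) = (\<Sum>c\<in>C. card ({..<r c} \<times> {j. j < length c \<and> \<kappa> (c ! j) = k}))"
      unfolding slots_def using finC by (intro card_SigmaI) auto
    also have "\<dots> = (\<Sum>c\<in>C. r c * cnt c k)"
      unfolding cnt_def
      by (intro sum.cong) (auto simp: card_cartesian_product card_nth_class C_def dcycle_def)
    finally show ?thesis .
  qed
  have y_le: "y k \<le> real (card (slots q k))" if "k \<in> K" for k
    unfolding card_slots y[OF that, symmetric] of_nat_sum of_nat_mult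
    by (intro sum_mono mult_right_mono z'_le_q) auto
  have le_y: "real (card (slots b k)) \<le> y k" if "k \<in> K" for k
    unfolding card_slots y[OF that, symmetric] of_nat_sum of_nat_mult
    by (intro sum_mono mult_right_mono b_le_z') auto
  define assigns where "assigns = (\<lambda>k (R, g). slots b k \<subseteq> R \<and> R \<subseteq> slots q k \<and> inj_on g R \<and>
      g ` R \<subseteq> {v \<in> V. \<kappa> v = k} \<and>
      min (card {v \<in> U. \<kappa> v = k}) (card (slots q k)) \<le> card ({v \<in> U. \<kappa> v = k} \<inter> g ` R))"
  have "\<exists>p. assigns k p" if k: "k \<in> K" for k
  proof -
    have 1: "finite {v \<in> V. \<kappa> v = k}" "{v \<in> U. \<kappa> v = k} \<subseteq> {v \<in> V. \<kappa> v = k}" using finV UV by auto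
    have 2: "slots b k \<subseteq> slots q k"
      unfolding slots_def using b_le_q by (intro Sigma_mono) (auto intro: less_le_trans)
    have 3: "card (slots b k) \<le> card {v \<in> V. \<kappa> v = k}"
      using le_y[OF k] cap[OF k] by linarith
    obtain R g where "slots b k \<subseteq> R" "R \<subseteq> slots q k" "inj_on g R" "g ` R \<subseteq> {v \<in> V. \<kappa> v = k}"
      "min (card {v \<in> U. \<kappa> v = k}) (card (slots q k)) \<le> card ({v \<in> U. \<kappa> v = k} \<inter> g ` R)"
      by (rule priority_assignment[OF 1 fin_slots 2 3])
    then have "assigns k (R, g)" by (simp add: assigns_def)
    then show ?thesis ..
  qed
  then obtain p where p: "\<And>k. k \<in> K \<Longrightarrow> assigns k (p k)" by metis
  define R where "R = (\<lambda>k. fst (p k))"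
  define g where "g = (\<lambda>k. snd (p k))"
  have R: "slots b k \<subseteq> R k" "R k \<subseteq> slots q k"
    and g: "inj_on (g k) (R k)" "g k ` R k \<subseteq> {v \<in> V. \<kappa> v = k}"
    and patients: "min (card {v \<in> U. \<kappa> v = k}) (card (slots q k))
      \<le> card ({v \<in> U. \<kappa> v = k} \<inter> g k ` R k)" if "k \<in> K" for k
    using p[OF that] by (simp_all add: assigns_def R_def g_def case_prod_beta)

  define cls where "cls = (\<lambda>s :: 'v list \<times> nat \<times> nat. \<kappa> (fst s ! snd (snd s)))"
  define occupied where "occupied = (\<lambda>s. s \<in> R (cls s))"
  define G where "G = (\<lambda>s. g (cls s) s)"
  define Kp where "Kp = {(c, m). c \<in> C \<and> m < q c \<and> (\<exists>j<length c. occupied (c, m, j))}"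
  define S where "S = {(c, m, j). (c, m) \<in> Kp \<and> j < length c}"
  define Q where "Q = {s \<in> S. \<not> occupied s}"
  have vert: "c ! j \<in> V" if "c \<in> C" "j < length c" for c j
    using that by (auto simp: C_def dcycle_def)
  have cls_K: "cls s \<in> K" if "s \<in> S" for s
    using that vert rep by (auto simp: S_def Kp_def cls_def represented_by_def)
  have G_V: "G s \<in> V" "\<kappa> (G s) = cls s" if "s \<in> S" "occupied s" for s
    using g(2)[OF cls_K[OF that(1)]] that(2) by (auto simp: G_def occupied_def)
  have Q_form: "m = b c" "c \<in> C" "0 < z' c" "j < length c" "(c, m) \<in> Kp"
    if s: "(c, m, j) \<in> Q" for c m j
  proof -
    show *: "c \<in> C" "j < length c" "(c, m) \<in> Kp" using s by (auto simp: Q_def S_def Kp_def)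
    have m: "m < q c" using s by (auto simp: Q_def S_def Kp_def)
    then show "0 < z' c" by (intro q_pos) auto
    have "\<not> m < b c"
    proof
      assume "m < b c"
      then have "(c, m, j) \<in> slots b (cls (c, m, j))" using * by (auto simp: slots_def cls_def)
      then show False using s R(1)[OF cls_K, of "(c, m, j)"] by (auto simp: Q_def occupied_def)
    qed
    then show "m = b c" using m q_le_b[of c] by linarith
  qed
  have Q_sub: "Q \<subseteq> (\<Union>c\<in>{c \<in> C. 0 < z' c}. (\<lambda>j. (c, b c, j)) ` {j. (c, b c, j) \<in> Q})"
    using Q_form by fastforce
  have J: "finite {j. (c, b c, j) \<in> Q}" "card {j. (c, b c, j) \<in> Q} \<le> \<Delta> - 1" for c
  proof -
    have sub: "{j. (c, b c, j) \<in> Q} \<subseteq> {..<length c}" using Q_form(4) by blast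
    then show "finite {j. (c, b c, j) \<in> Q}" by (rule finite_subset) simp
    show "card {j. (c, b c, j) \<in> Q} \<le> \<Delta> - 1"
    proof (cases "{j. (c, b c, j) \<in> Q} = {}")
      case False
      then obtain j where j: "(c, b c, j) \<in> Q" by blast
      obtain j0 where j0: "j0 < length c" "occupied (c, b c, j0)"
        using Q_form(5)[OF j] by (auto simp: Kp_def)
      then have "{j. (c, b c, j) \<in> Q} \<subseteq> {..<length c} - {j0}"
        using sub by (auto simp: Q_def)
      then have "card {j. (c, b c, j) \<in> Q} \<le> card ({..<length c} - {j0})" by (intro card_mono) auto
      also have "\<dots> \<le> length c - 1" using j0 by simp
      also have "\<dots> \<le> \<Delta> - 1" using Q_form(2)[OF j] by (auto simp: C_def)
      finally show ?thesis .
    qed (simp del: Collect_empty_eq)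
  qed
  have finQ: "finite Q"
    by (rule finite_subset[OF Q_sub]) (use finC J in auto)
  have "card Q \<le> card (\<Union>c\<in>{c \<in> C. 0 < z' c}. (\<lambda>j. (c, b c, j)) ` {j. (c, b c, j) \<in> Q})"
    using Q_sub finC J by (intro card_mono) auto
  also have "\<dots> \<le> (\<Sum>c\<in>{c \<in> C. 0 < z' c}. card ((\<lambda>j. (c, b c, j)) ` {j. (c, b c, j) \<in> Q}))"
    using finC by (intro card_UN_le) auto
  also have "\<dots> \<le> (\<Sum>c\<in>{c \<in> C. 0 < z' c}. \<Delta> - 1)"
    using J by (intro sum_mono) (meson card_image_le le_trans)
  also have "\<dots> \<le> (\<Delta> - 1) * card K" using supp by simp
  finally have cardQ: "card Q \<le> (\<Delta> - 1) * card K" .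
  obtain h :: "'v list \<times> nat \<times> nat \<Rightarrow> nat" where h: "inj_on h Q"
    using finite_imp_inj_to_nat_seg[OF finQ] by blast

  define \<phi> where "\<phi> = (\<lambda>s. if occupied s then Inl (G s) else Inr (h s))"
  define cyc where "cyc = (\<lambda>(c, m). map (\<lambda>j. \<phi> (c, m, j)) [0..<length c])"
  have inj\<phi>: "inj_on \<phi> S"
  proof (rule inj_onI)
    fix s s' assume s: "s \<in> S" "s' \<in> S" "\<phi> s = \<phi> s'"
    show "s = s'"
    proof (cases "occupied s")
      case True
      then have d: "occupied s'" "G s = G s'" using s(3) by (auto simp: \<phi>_def split: if_splits)
      then have "cls s = cls s'" using G_V(2) s True by metis
      then show ?thesis
        using d True inj_onD[OF g(1)[OF cls_K[OF s(1)]], of s s'] by (auto simp: occupied_def G_def)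
    next
      case False
      then have "\<not> occupied s'" "h s = h s'" using s(3) by (auto simp: \<phi>_def split: if_splits)
      then show ?thesis using False s inj_onD[OF h, of s s'] by (auto simp: Q_def)
    qed
  qed
  define A where "A = h ` Q"
  have \<phi>_vert: "\<phi> s \<in> ext_vertices V A" if "s \<in> S" for s
    using that G_V by (auto simp: \<phi>_def ext_vertices_def A_def Q_def)
  have set_cyc: "set (cyc (c, m)) = \<phi> ` {(c, m, j) | j. j < length c}" for c m
    by (auto simp: cyc_def)
  have cyc: "dcycle (ext_arcs E V A (\<lambda>_. V)) (ext_vertices V A) (cyc (c, m))"
    "length (cyc (c, m)) \<le> \<Delta>" if cm: "(c, m) \<in> Kp" for c m
  proof -
    have c: "c \<in> C" "distinct c" "c \<noteq> []" "length c \<le> \<Delta>"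
      using cm by (auto simp: Kp_def C_def dcycle_def)
    have arc: "(c ! j, c ! ((j + 1) mod length c)) \<in> E" if "j < length c" for j
      using c(1) that by (auto simp: C_def dcycle_def)
    have inS: "(c, m, j) \<in> S" if "j < length c" for j using cm that by (auto simp: S_def)
    show "length (cyc (c, m)) \<le> \<Delta>" using c by (simp add: cyc_def)
    have "(\<phi> (c, m, j), \<phi> (c, m, (j + 1) mod length c)) \<in> ext_arcs E V A (\<lambda>_. V)"
      if j: "j < length c" for j
    proof -
      define j' where "j' = (j + 1) mod length c"
      have j': "j' < length c" unfolding j'_def using c(3) by (intro mod_less_divisor) simp
      have E: "(c ! j, c ! j') \<in> E" using arc[OF j] by (simp add: j'_def)
      have ne: "c ! j \<noteq> c ! j'"
        using E rep vert[OF c(1) j] unfolding represented_by_def by metis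
      then have \<phi>_ne: "\<phi> (c, m, j) \<noteq> \<phi> (c, m, j')"
        using inj_onD[OF inj\<phi> _ inS[OF j] inS[OF j']] by auto
      have "(\<phi> (c, m, j), \<phi> (c, m, j')) \<in> ext_arcs E V A (\<lambda>_. V)"
      proof (cases "occupied (c, m, j')")
        case False
        then have "h (c, m, j') \<in> A" using inS[OF j'] by (auto simp: A_def Q_def)
        then show ?thesis
          using False \<phi>_ne \<phi>_vert[OF inS[OF j]] by (auto simp: ext_arcs_def \<phi>_def)
      next
        case target: True
        show ?thesis
        proof (cases "occupied (c, m, j)")
          case False
          then have "h (c, m, j) \<in> A" using inS[OF j] by (auto simp: A_def Q_def)
          then show ?thesis
            using False target G_V(1)[OF inS[OF j'] target] by (auto simp: ext_arcs_def \<phi>_def)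
        next
          case True
          have "G (c, m, j) \<noteq> G (c, m, j')" using \<phi>_ne True target by (auto simp: \<phi>_def)
          moreover have "\<kappa> (G (c, m, j)) = \<kappa> (c ! j)" "\<kappa> (G (c, m, j')) = \<kappa> (c ! j')"
            using G_V(2)[OF inS[OF j] True] G_V(2)[OF inS[OF j'] target] by (auto simp: cls_def)
          moreover have "G (c, m, j) \<in> V" "G (c, m, j') \<in> V" "c ! j \<in> V" "c ! j' \<in> V"
            using G_V(1)[OF inS[OF j] True] G_V(1)[OF inS[OF j'] target] vert c(1) j j' by auto
          ultimately have "(G (c, m, j), G (c, m, j')) \<in> E"
            using rep ne E unfolding represented_by_def by metis
          then show ?thesis using True target by (auto simp: ext_arcs_def \<phi>_def)
        qed
      qed
      then show ?thesis by (simp add: j'_def)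
    qed
    moreover have "distinct (cyc (c, m))"
      using inj_onD[OF inj\<phi>] inS by (auto simp: cyc_def distinct_map inj_on_def)
    moreover have "set (cyc (c, m)) \<subseteq> ext_vertices V A"
      using \<phi>_vert inS by (auto simp: cyc_def)
    ultimately show "dcycle (ext_arcs E V A (\<lambda>_. V)) (ext_vertices V A) (cyc (c, m))"
      using c by (auto simp: dcycle_def cyc_def)
  qed
  define X where "X = cyc ` Kp"
  have disj: "set (cyc p) \<inter> set (cyc p') = {}" if p: "p \<in> Kp" "p' \<in> Kp" "p \<noteq> p'" for p p'
  proof (rule ccontr)
    obtain c m c' m' where e: "p = (c, m)" "p' = (c', m')" by (cases p, cases p')
    assume "set (cyc p) \<inter> set (cyc p') \<noteq> {}"
    then obtain j j' where "j < length c" "j' < length c'" "\<phi> (c, m, j) = \<phi> (c', m', j')"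
      by (auto simp: e set_cyc)
    then have "(c, m, j) = (c', m', j')"
      using p by (intro inj_onD[OF inj\<phi>]) (auto simp: e S_def)
    then show False using p e by auto
  qed
  have "is_exchange (ext_arcs E V A (\<lambda>_. V)) \<Delta> (ext_vertices V A) X"
    unfolding is_exchange_def X_def using cyc disj by (auto simp del: Int_iff) blast+
  moreover have "min (real (card {v \<in> U. \<kappa> v = k})) (y k)
      \<le> real (card (Inl ` {v \<in> U. \<kappa> v = k} \<inter> covered X))" if k: "k \<in> K" for k
  proof -
    let ?U = "{v \<in> U. \<kappa> v = k}"
    have finU: "finite ?U" using finV UV by (auto intro: finite_subset)
    have "Inl (g k s) \<in> covered X" if s: "s \<in> R k" for s
    proof -
      obtain c m j where e: "s = (c, m, j)" by (cases s)
      have sl: "c \<in> C" "m < q c" "j < length c" "\<kappa> (c ! j) = k"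
        using R(2)[OF k] s by (auto simp: slots_def e)
      then have d: "occupied s" using s by (simp add: occupied_def cls_def e)
      then have "(c, m) \<in> Kp" using sl e by (auto simp: Kp_def)
      moreover have "\<phi> s = Inl (g k s)" using d sl by (simp add: \<phi>_def G_def cls_def e)
      moreover have "\<phi> s \<in> set (cyc (c, m))" using sl by (auto simp: set_cyc e)
      ultimately show ?thesis by (force simp: covered_def X_def)
    qed
    then have sub: "Inl ` (?U \<inter> g k ` R k) \<subseteq> Inl ` ?U \<inter> covered X" by auto
    have "min (real (card ?U)) (y k) \<le> real (min (card ?U) (card (slots q k)))"
      using y_le[OF k] by auto
    also have "\<dots> \<le> real (card (?U \<inter> g k ` R k))" using patients[OF k] by linarith
    also have "\<dots> = real (card ((Inl :: 'v \<Rightarrow> 'v + nat) ` (?U \<inter> g k ` R k)))" by (simp add: card_image)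
    also have "\<dots> \<le> real (card (Inl ` ?U \<inter> covered X))"
      using sub finU by (intro of_nat_mono card_mono) auto
    finally show ?thesis .
  qed
  moreover have "finite A" "card A \<le> (\<Delta> - 1) * card K"
    using finQ cardQ card_image[OF h] by (auto simp: A_def)
  ultimately show thesis using that by blast
qed

lemma covered_subset: "is_exchange E \<Delta> W X \<Longrightarrow> covered X \<subseteq> W"
  by (auto simp: is_exchange_def covered_def dcycle_def)

lemma card_Int_covered:
  assumes "finite X" "is_exchange E \<Delta> W X"
  shows "card (Q \<inter> covered X) = (\<Sum>c\<in>X. card (Q \<inter> set c))"
proof -
  have "Q \<inter> covered X = (\<Union>c\<in>X. Q \<inter> set c)" by (auto simp: covered_def)
  also have "card \<dots> = (\<Sum>c\<in>X. card (Q \<inter> set c))"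
    using assms unfolding is_exchange_def by (intro card_UN_disjoint) (simp, simp, blast)
  finally show ?thesis .
qed

lemma card_eq_sum_classes:
  assumes "finite Q" "finite T" "f ` Q \<subseteq> T"
  shows "card Q = (\<Sum>\<tau>\<in>T. card {v \<in> Q. f v = \<tau>})"
proof -
  have "Q = (\<Union>\<tau>\<in>T. {v \<in> Q. f v = \<tau>})" using assms by auto
  also have "card \<dots> = (\<Sum>\<tau>\<in>T. card {v \<in> Q. f v = \<tau>})"
    using assms by (intro card_UN_disjoint) auto
  finally show ?thesis .
qed

lemma fractional_core:
  fixes E :: "('v \<times> 'v) set" and \<Delta> n :: nat and Vs Us :: "nat \<Rightarrow> 'v set"
  defines "C \<equiv> {c. dcycle E (\<Union>i\<in>{1..n}. Vs i) c \<and> length c \<le> \<Delta>}"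
  assumes fin: "\<forall>i\<in>{1..n}. finite (Vs i)"
    and disj: "\<forall>i\<in>{1..n}. \<forall>j\<in>{1..n}. i \<noteq> j \<longrightarrow> Vs i \<inter> Vs j = {}"
    and pat: "\<forall>i\<in>{1..n}. Us i \<subseteq> Vs i"
  obtains z :: "'v list \<Rightarrow> real" and W :: "nat \<Rightarrow> nat"
  where "\<And>c. 0 \<le> z c"
    and "\<And>i Q. i \<in> {1..n} \<Longrightarrow> Q \<subseteq> Vs i \<Longrightarrow> (\<Sum>c\<in>C. z c * real (card (Q \<inter> set c))) \<le> real (card Q)"
    and "\<And>i. i \<in> {1..n} \<Longrightarrow> real (W i) - 1 < (\<Sum>c\<in>C. z c * real (card (Us i \<inter> set c)))"
    and "\<And>P Y. P \<noteq> {} \<Longrightarrow> P \<subseteq> {1..n} \<Longrightarrow> is_exchange E \<Delta> (\<Union>i\<in>P. Vs i) Y \<Longrightarrow>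
           \<exists>i\<in>P. util (Us i) Y \<le> W i"
proof -
  define V where "V = (\<Union>i\<in>{1..n}. Vs i)"
  have finV: "finite V" using fin by (auto simp: V_def)
  have finC: "finite C" unfolding C_def V_def[symmetric] by (rule finite_dcycles[OF finV])
  define K where "K = {(P, Y). P \<noteq> {} \<and> P \<subseteq> {1..n} \<and> is_exchange E \<Delta> (\<Union>i\<in>P. Vs i) Y}"
  have K: "fst k \<noteq> {}" "fst k \<subseteq> {1..n}" "is_exchange E \<Delta> (\<Union>i\<in>fst k. Vs i) (snd k)"
    if "k \<in> K" for k using that by (auto simp: K_def)
  have YC: "snd k \<subseteq> C" if "k \<in> K" for k
  proof
    fix c assume "c \<in> snd k"
    then have c: "dcycle E (\<Union>i\<in>fst k. Vs i) c" "length c \<le> \<Delta>"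
      using K(3)[OF that] by (auto simp: is_exchange_def)
    moreover have "(\<Union>i\<in>fst k. Vs i) \<subseteq> (\<Union>i\<in>{1..n}. Vs i)" using K(2)[OF that] by blast
    ultimately show "c \<in> C" by (simp add: C_def dcycle_def) blast
  qed
  have finK: "finite K"
  proof (rule finite_subset)
    show "K \<subseteq> Pow {1..n} \<times> Pow C" using K(2) YC by fastforce
  qed (use finC in auto)
  have finU: "finite (Us i)" if "i \<in> {1..n}" for i
    using that fin pat finite_subset by blast
  define B where "B = (\<Sum>i\<in>{1..n}. card (Us i))"
  define \<eta> where "\<eta> = 1 / (real B + 2)"
  have \<eta>: "0 < \<eta>" "\<eta> < 1" "\<eta> * real B < 1" by (auto simp: \<eta>_def field_simps)
  have util_B: "util (Us i) Y \<le> B" if "i \<in> {1..n}" for i Y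
  proof -
    have "util (Us i) Y \<le> card (Us i)"
      unfolding util_def using finU[OF that] by (intro card_mono) auto
    also have "\<dots> \<le> B" unfolding B_def using that by (intro member_le_sum) auto
    finally show ?thesis .
  qed
  obtain x W where x: "\<And>k. k \<in> K \<Longrightarrow> 0 \<le> x k"
    and lo: "\<And>i. i \<in> {1..n} \<Longrightarrow> 1 - \<eta> \<le> (\<Sum>k | k \<in> K \<and> i \<in> fst k. x k)"
    and hi: "\<And>i. i \<in> {1..n} \<Longrightarrow> (\<Sum>k | k \<in> K \<and> i \<in> fst k. x k) \<le> 1"
    and W: "\<And>k i. k \<in> K \<Longrightarrow> 0 < x k \<Longrightarrow> i \<in> fst k \<Longrightarrow> W i \<le> util (Us i) (snd k)"
    and core: "\<And>k. k \<in> K \<Longrightarrow> \<exists>i\<in>fst k. util (Us i) (snd k) \<le> W i"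
  proof (rule approximate_balanced_core[of K fst n \<eta> "\<lambda>k i. util (Us i) (snd k)"])
    fix i assume "i \<in> {1..n}"
    then show "\<exists>k\<in>K. fst k = {i}"
      by (intro bexI[of _ "({i}, {})"]) (auto simp: K_def is_exchange_def)
  qed (use finK K \<eta> in auto)
  define z where "z = (\<lambda>c. \<Sum>k | k \<in> K \<and> c \<in> snd k. x k)"
  have use_eq: "(\<Sum>c\<in>C. z c * real (card (Q \<inter> set c)))
      = (\<Sum>k | k \<in> K \<and> i \<in> fst k. x k * real (card (Q \<inter> covered (snd k))))"
    if i: "i \<in> {1..n}" "Q \<subseteq> Vs i" for i Q
  proof -
    have "(\<Sum>c\<in>C. z c * real (card (Q \<inter> set c)))
        = (\<Sum>c\<in>C. \<Sum>k | k \<in> K \<and> c \<in> snd k. x k * real (card (Q \<inter> set c)))"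
      by (simp add: z_def sum_distrib_right)
    also have "\<dots> = (\<Sum>k\<in>K. \<Sum>c | c \<in> C \<and> c \<in> snd k. x k * real (card (Q \<inter> set c)))"
      using finC finK by (rule sum.swap_restrict)
    also have "\<dots> = (\<Sum>k\<in>K. x k * real (card (Q \<inter> covered (snd k))))"
    proof (rule sum.cong[OF refl])
      fix k assume k: "k \<in> K"
      have snd_k: "{c. c \<in> C \<and> c \<in> snd k} = snd k" using YC[OF k] by auto
      have "finite (snd k)" using YC[OF k] finC finite_subset by blast
      then have "card (Q \<inter> covered (snd k)) = (\<Sum>c\<in>snd k. card (Q \<inter> set c))"
        by (rule card_Int_covered[OF _ K(3)[OF k]])
      then have "x k * real (card (Q \<inter> covered (snd k))) = (\<Sum>c\<in>snd k. x k * real (card (Q \<inter> set c)))"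
        by (simp add: sum_distrib_left)
      then show "(\<Sum>c | c \<in> C \<and> c \<in> snd k. x k * real (card (Q \<inter> set c)))
          = x k * real (card (Q \<inter> covered (snd k)))"
        unfolding snd_k by (rule sym)
    qed
    also have "\<dots> = (\<Sum>k | k \<in> K \<and> i \<in> fst k. x k * real (card (Q \<inter> covered (snd k))))"
    proof (intro sum.mono_neutral_right ballI)
      fix k assume "k \<in> K - {k. k \<in> K \<and> i \<in> fst k}"
      then have k: "k \<in> K" "i \<notin> fst k" by auto
      have "Vs i \<inter> Vs j = {}" if "j \<in> fst k" for j
        using K(2)[OF k(1)] k(2) i(1) disj that by (metis subsetD)
      then have "Q \<inter> covered (snd k) = {}"
        using covered_subset[OF K(3)[OF k(1)]] i(2) by blast
      then show "x k * real (card (Q \<inter> covered (snd k))) = 0" by simp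
    qed (use finK in auto)
    finally show ?thesis .
  qed
  show thesis
  proof (rule that[of z W])
    show "0 \<le> z c" for c unfolding z_def using x by (intro sum_nonneg) auto
  next
    fix i Q assume i: "i \<in> {1..n}" "Q \<subseteq> Vs i"
    have finQ: "finite Q" using i fin finite_subset by blast
    have "(\<Sum>c\<in>C. z c * real (card (Q \<inter> set c)))
        \<le> (\<Sum>k | k \<in> K \<and> i \<in> fst k. x k * real (card Q))"
      unfolding use_eq[OF i] using x finQ
      by (intro sum_mono mult_left_mono of_nat_mono card_mono) auto
    also have "\<dots> = (\<Sum>k | k \<in> K \<and> i \<in> fst k. x k) * real (card Q)"
      by (simp add: sum_distrib_right)
    also have "\<dots> \<le> 1 * real (card Q)" using hi[OF i(1)] by (intro mult_right_mono) auto
    finally show "(\<Sum>c\<in>C. z c * real (card (Q \<inter> set c))) \<le> real (card Q)" by simp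
  next
    fix i assume i: "i \<in> {1..n}"
    have "\<exists>k. k \<in> K \<and> i \<in> fst k \<and> 0 < x k"
    proof (rule ccontr)
      assume "\<not> ?thesis"
      then have "(\<Sum>k | k \<in> K \<and> i \<in> fst k. x k) \<le> 0" by (intro sum_nonpos) force
      then show False using lo[OF i] \<eta> by linarith
    qed
    then have WB: "W i \<le> B" using W util_B[OF i] le_trans by meson
    have "real (W i) - 1 < real (W i) - \<eta> * real B" using \<eta> by linarith
    also have "\<dots> \<le> (1 - \<eta>) * real (W i)"
      using WB \<eta> by (simp add: algebra_simps mult_left_mono)
    also have "\<dots> \<le> (\<Sum>k | k \<in> K \<and> i \<in> fst k. x k) * real (W i)"
      using lo[OF i] by (intro mult_right_mono) auto
    also have "\<dots> = (\<Sum>k | k \<in> K \<and> i \<in> fst k. x k * real (W i))"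
      by (simp add: sum_distrib_right)
    also have "\<dots> \<le> (\<Sum>k | k \<in> K \<and> i \<in> fst k. x k * real (util (Us i) (snd k)))"
    proof (rule sum_mono)
      fix k assume "k \<in> {k. k \<in> K \<and> i \<in> fst k}"
      then show "x k * real (W i) \<le> x k * real (util (Us i) (snd k))"
        using x[of k] W[of k i] by (cases "x k = 0") (auto intro!: mult_left_mono)
    qed
    also have "\<dots> = (\<Sum>c\<in>C. z c * real (card (Us i \<inter> set c)))"
      using use_eq[OF i] pat i by (simp add: util_def)
    finally show "real (W i) - 1 < (\<Sum>c\<in>C. z c * real (card (Us i \<inter> set c)))" .
  next
    fix P Y assume "P \<noteq> {}" "P \<subseteq> {1..n}" "is_exchange E \<Delta> (\<Union>i\<in>P. Vs i) Y"
    then show "\<exists>i\<in>P. util (Us i) Y \<le> W i" using core[of "(P, Y)"] by (auto simp: K_def)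
  qed
qed

theorem mainTheorem9:
  fixes E :: "('v \<times> 'v) set" and \<Delta> n t :: nat
    and Vs Us :: "nat \<Rightarrow> 'v set" and T :: "nat set" and f :: "'v \<Rightarrow> nat"
  assumes fin: "\<forall>i\<in>{1..n}. finite (Vs i)"
    and disj: "\<forall>i\<in>{1..n}. \<forall>j\<in>{1..n}. i \<noteq> j \<longrightarrow> Vs i \<inter> Vs j = {}"
    and pat: "\<forall>i\<in>{1..n}. Us i \<subseteq> Vs i"
    and arcs: "E \<subseteq> (\<Union>i\<in>{1..n}. Vs i) \<times> (\<Union>i\<in>{1..n}. Vs i)"
    and Delta: "\<Delta> \<ge> 2"
    and types: "finite T" "card T = t" "represented_by E (\<Union>i\<in>{1..n}. Vs i) T f"
  shows "\<exists>A :: nat set. finite A \<and> card A \<le> (\<Delta> - 1) * n * (t + 1) \<and>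
           (\<exists>out. (\<forall>a\<in>A. out a \<subseteq> (\<Union>i\<in>{1..n}. Vs i)) \<and>
              (\<exists>X. in_supp_core E \<Delta> Vs Us n A out X \<and>
                   ext_pareto_optimal E \<Delta> Vs Us n A out X))"
proof -
  define V where "V = (\<Union>i\<in>{1..n}. Vs i)"
  define U where "U = (\<Union>i\<in>{1..n}. Us i)"
  define C where "C = {c. dcycle E V c \<and> length c \<le> \<Delta>}"
  have finV: "finite V" and UV: "U \<subseteq> V" using fin pat by (auto simp: V_def U_def)
  have finU: "finite (Us i)" if "i \<in> {1..n}" for i
    using that fin pat finite_subset by blast
  obtain z W where z: "\<And>c. 0 \<le> z c"
    and cap: "\<And>i Q. i \<in> {1..n} \<Longrightarrow> Q \<subseteq> Vs i \<Longrightarrow>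
      (\<Sum>c\<in>C. z c * real (card (Q \<inter> set c))) \<le> real (card Q)"
    and W: "\<And>i. i \<in> {1..n} \<Longrightarrow> real (W i) - 1 < (\<Sum>c\<in>C. z c * real (card (Us i \<inter> set c)))"
    and core: "\<And>P Y. P \<noteq> {} \<Longrightarrow> P \<subseteq> {1..n} \<Longrightarrow> is_exchange E \<Delta> (\<Union>i\<in>P. Vs i) Y \<Longrightarrow>
           \<exists>i\<in>P. util (Us i) Y \<le> W i"
    unfolding C_def V_def
    by (rule fractional_core[OF fin disj pat, of E \<Delta>]) blast
  define \<kappa> where "\<kappa> = (\<lambda>v. (THE i. i \<in> {1..n} \<and> v \<in> Vs i, f v))"
  have \<kappa>: "\<kappa> v = (i, f v)" if "i \<in> {1..n}" "v \<in> Vs i" for i v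
  proof -
    have "(THE i. i \<in> {1..n} \<and> v \<in> Vs i) = i" using that disj by (intro the_equality) blast+
    then show ?thesis by (simp add: \<kappa>_def)
  qed
  have fV: "f v \<in> T" if "v \<in> V" for v using that types(3) by (auto simp: represented_by_def V_def)
  have rep: "represented_by E V ({1..n} \<times> T) \<kappa>"
  proof -
    have "\<kappa> ` V \<subseteq> {1..n} \<times> T" using \<kappa> fV by (fastforce simp: V_def)
    moreover have "f u = f v" if "\<kappa> u = \<kappa> v" for u v using that by (simp add: \<kappa>_def)
    ultimately show ?thesis
      using types(3) unfolding represented_by_def V_def[symmetric] by metis
  qed
  have V_cls: "{v \<in> V. \<kappa> v = (i, \<tau>)} = {v \<in> Vs i. f v = \<tau>}"
    and U_cls: "{v \<in> U. \<kappa> v = (i, \<tau>)} = {v \<in> Us i. f v = \<tau>}" if i: "i \<in> {1..n}" for i \<tau>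
    using i \<kappa> pat by (auto simp: V_def U_def) fastforce+
  have use_cls: "(\<Sum>c\<in>C. z c * real (card {v \<in> set c. \<kappa> v = (i, \<tau>)}))
      = (\<Sum>c\<in>C. z c * real (card ({v \<in> Vs i. f v = \<tau>} \<inter> set c)))" if i: "i \<in> {1..n}" for i \<tau>
  proof (rule sum.cong[OF refl])
    fix c assume "c \<in> C"
    then have "set c \<subseteq> V" by (auto simp: C_def dcycle_def)
    then have "{v \<in> set c. \<kappa> v = (i, \<tau>)} = {v \<in> Vs i. f v = \<tau>} \<inter> set c"
      using V_cls[OF i, of \<tau>] by blast
    then show "z c * real (card {v \<in> set c. \<kappa> v = (i, \<tau>)})
      = z c * real (card ({v \<in> Vs i. f v = \<tau>} \<inter> set c))" by simp
  qed
  obtain A X where A: "finite A" "card A \<le> (\<Delta> - 1) * card ({1..n} \<times> T)"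
    and X: "is_exchange (ext_arcs E V A (\<lambda>_. V)) \<Delta> (ext_vertices V A) X"
    and cov: "\<And>k. k \<in> {1..n} \<times> T \<Longrightarrow>
      min (real (card {v \<in> U. \<kappa> v = k})) (\<Sum>c\<in>C. z c * real (card {v \<in> set c. \<kappa> v = k}))
        \<le> real (card (Inl ` {v \<in> U. \<kappa> v = k} \<inter> covered X))"
  proof (rule round_up_fractional_exchange[OF finV _ UV rep, of \<Delta> z])
    fix k assume "k \<in> {1..n} \<times> T"
    then obtain i \<tau> where k: "k = (i, \<tau>)" "i \<in> {1..n}" by auto
    have "(\<Sum>c\<in>C. z c * real (card {v \<in> set c. \<kappa> v = k})) \<le> real (card {v \<in> V. \<kappa> v = k})"
      unfolding k(1) V_cls[OF k(2)] use_cls[OF k(2)] using k(2) by (intro cap) auto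
    then show "(\<Sum>c | dcycle E V c \<and> length c \<le> \<Delta>. z c * real (card {v \<in> set c. \<kappa> v = k}))
        \<le> real (card {v \<in> V. \<kappa> v = k})" by (simp add: C_def)
  qed (use types z in \<open>auto simp: C_def\<close>)
  have X_W: "W i \<le> util (Inl ` Us i) X" if i: "i \<in> {1..n}" for i
  proof -
    define Q where "Q = (\<lambda>\<tau>. {v \<in> Us i. f v = \<tau>})"
    have QV: "Q \<tau> \<subseteq> {v \<in> Vs i. f v = \<tau>}" for \<tau> using pat i by (auto simp: Q_def)
    have fT: "f ` Us i \<subseteq> T" using fV pat i unfolding V_def by blast
    have "real (W i) - 1 < (\<Sum>c\<in>C. z c * real (card (Us i \<inter> set c)))" by (rule W[OF i])
    also have "\<dots> = (\<Sum>c\<in>C. \<Sum>\<tau>\<in>T. z c * real (card (Q \<tau> \<inter> set c)))"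
    proof (rule sum.cong[OF refl])
      fix c
      have "card (Us i \<inter> set c) = (\<Sum>\<tau>\<in>T. card {v \<in> Us i \<inter> set c. f v = \<tau>})"
        using fT types(1) by (intro card_eq_sum_classes) auto
      also have "\<dots> = (\<Sum>\<tau>\<in>T. card (Q \<tau> \<inter> set c))"
        by (intro sum.cong refl arg_cong[of _ _ card]) (auto simp: Q_def)
      finally show "z c * real (card (Us i \<inter> set c)) = (\<Sum>\<tau>\<in>T. z c * real (card (Q \<tau> \<inter> set c)))"
        by (simp add: sum_distrib_left)
    qed
    also have "\<dots> = (\<Sum>\<tau>\<in>T. \<Sum>c\<in>C. z c * real (card (Q \<tau> \<inter> set c)))" by (rule sum.swap)
    also have "\<dots> \<le> (\<Sum>\<tau>\<in>T. real (card (Inl ` Q \<tau> \<inter> covered X)))"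
    proof (rule sum_mono)
      fix \<tau> assume \<tau>: "\<tau> \<in> T"
      have "(\<Sum>c\<in>C. z c * real (card (Q \<tau> \<inter> set c))) \<le> real (card (Q \<tau>))"
        using QV i by (intro cap[OF i]) auto
      moreover have "(\<Sum>c\<in>C. z c * real (card (Q \<tau> \<inter> set c)))
          \<le> (\<Sum>c\<in>C. z c * real (card ({v \<in> Vs i. f v = \<tau>} \<inter> set c)))"
        using QV[of \<tau>] z by (intro sum_mono mult_left_mono of_nat_mono card_mono) auto
      ultimately show "(\<Sum>c\<in>C. z c * real (card (Q \<tau> \<inter> set c))) \<le> real (card (Inl ` Q \<tau> \<inter> covered X))"
        using cov[of "(i, \<tau>)"] i \<tau> unfolding U_cls[OF i] use_cls[OF i] Q_def by auto
    qed
    also have "\<dots> = real (util (Inl ` Us i) X)"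
    proof -
      have "util (Inl ` Us i) X
          = (\<Sum>\<tau>\<in>T. card {w \<in> Inl ` Us i \<inter> covered X. f (projl w) = \<tau>})"
        unfolding util_def using fT types(1) finU[OF i] by (intro card_eq_sum_classes) auto
      also have "\<dots> = (\<Sum>\<tau>\<in>T. card (Inl ` Q \<tau> \<inter> covered X))"
        by (intro sum.cong refl arg_cong[of _ _ card]) (auto simp: Q_def)
      finally show ?thesis by simp
    qed
    finally show ?thesis by linarith
  qed

  define good where "good = (\<lambda>X. is_exchange (ext_arcs E V A (\<lambda>_. V)) \<Delta> (ext_vertices V A) X \<and>
    (\<forall>i\<in>{1..n}. W i \<le> util (Inl ` Us i) X))"
  define total where "total = (\<lambda>X :: ('v + nat) list set. \<Sum>i\<in>{1..n}. util (Inl ` Us i) X)"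
  have "total Y \<le> (\<Sum>i\<in>{1..n}. card (Us i))" for Y
    unfolding total_def
  proof (rule sum_mono)
    fix i assume i: "i \<in> {1..n}"
    have "util (Inl ` Us i) Y \<le> card ((Inl :: 'v \<Rightarrow> 'v + nat) ` Us i)"
      unfolding util_def using finU[OF i] by (intro card_mono) auto
    then show "util (Inl ` Us i) Y \<le> card (Us i)" by (simp add: card_image)
  qed
  then have "\<forall>Y. good Y \<longrightarrow> total Y < Suc (\<Sum>i\<in>{1..n}. card (Us i))" by (simp add: less_Suc_eq_le)
  moreover have "good X" using X X_W by (auto simp: good_def)
  ultimately obtain Z where Z: "good Z" and max: "\<And>Y. good Y \<Longrightarrow> total Y \<le> total Z"
    using ex_has_greatest_nat[of good X total] by metis
  have "in_supp_core E \<Delta> Vs Us n A (\<lambda>_. V) Z"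
    unfolding in_supp_core_def blocks_def V_def[symmetric]
  proof (intro conjI allI notI)
    show "is_exchange (ext_arcs E V A (\<lambda>_. V)) \<Delta> (ext_vertices V A) Z" using Z by (simp add: good_def)
    fix P assume "P \<noteq> {} \<and> P \<subseteq> {1..n} \<and> (\<exists>X'. is_exchange E \<Delta> (\<Union>i\<in>P. Vs i) X' \<and>
        (\<forall>i\<in>P. util (Us i) X' > util (Inl ` Us i) Z))"
    then obtain Y where Y: "P \<noteq> {}" "P \<subseteq> {1..n}" "is_exchange E \<Delta> (\<Union>i\<in>P. Vs i) Y"
      "\<forall>i\<in>P. util (Us i) Y > util (Inl ` Us i) Z" by blast
    then obtain i where "i \<in> P" "util (Us i) Y \<le> W i" using core by blast
    then show False using Y Z by (fastforce simp: good_def)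
  qed
  moreover have "ext_pareto_optimal E \<Delta> Vs Us n A (\<lambda>_. V) Z"
    unfolding ext_pareto_optimal_def V_def[symmetric]
  proof (intro conjI notI)
    show "is_exchange (ext_arcs E V A (\<lambda>_. V)) \<Delta> (ext_vertices V A) Z" using Z by (simp add: good_def)
    assume "\<exists>X'. is_exchange (ext_arcs E V A (\<lambda>_. V)) \<Delta> (ext_vertices V A) X' \<and>
      (\<forall>i\<in>{1..n}. util (Inl ` Us i) X' \<ge> util (Inl ` Us i) Z) \<and>
      (\<exists>i\<in>{1..n}. util (Inl ` Us i) X' > util (Inl ` Us i) Z)"
    then obtain Y where Y: "is_exchange (ext_arcs E V A (\<lambda>_. V)) \<Delta> (ext_vertices V A) Y"
      "\<forall>i\<in>{1..n}. util (Inl ` Us i) Y \<ge> util (Inl ` Us i) Z"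
      "\<exists>i\<in>{1..n}. util (Inl ` Us i) Y > util (Inl ` Us i) Z" by blast
    then have "good Y" using Z le_trans unfolding good_def by blast
    moreover have "total Z < total Y" unfolding total_def using Y by (intro sum_strict_mono_ex1) auto
    ultimately show False using max[of Y] by simp
  qed
  moreover have "card A \<le> (\<Delta> - 1) * n * (t + 1)"
  proof -
    have "card A \<le> (\<Delta> - 1) * n * t" using A(2) types(2) by (simp add: card_cartesian_product mult.assoc)
    also have "\<dots> \<le> (\<Delta> - 1) * n * (t + 1)" by (intro mult_left_mono) auto
    finally show ?thesis .
  qed
  ultimately show ?thesis
    using A(1) unfolding V_def by (intro exI[of _ A] conjI exI[of _ "\<lambda>_. \<Union>i\<in>{1..n}. Vs i"]) auto
qed

end
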